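(* Let $(b_0,b_1,\dots,b_m)$ with $b_0=n$ be a characteristic sequence, with associated index set $I$, variables $A=(A_i)_{i\in I}$, $C=(C_{ij})_{(i,j)\in\mathbb{Z}_{\ge 0}^2}$ and polynomials $F=(F_{ij})_{(i,j)\in\mathbb{Z}_{\ge 0}^2}$, $F_{ij}\in\mathbb{C}[A]$, as defined in the context. Let $Q\in\mathbb{C}[A]$ be $U_n$-invariant. Then there exist polynomials $V,W\in\mathbb{C}[C]$ such that $$Q=\frac{W(F)}{V(F)}$$ and $V(F)$ is a monomial in the variables $A_{b_1},\dots,A_{b_m}$.
   Context: A characteristic sequence is a sequence $(b_0,b_1,\dots,b_m)$ of positive integers with $b_0=n$, $b_1<b_2<\dots<b_m$, such that, with $e_k:=\gcd(b_0,\dots,b_k)$ for $k=0,\dots,m$, one has $e_0>e_1>\dots>e_m=1$. Put $$I=e_0\mathbb{N}_{+}\cup\bigcup_{i=1}^m\bigl(e_i\mathbb{N}\cap[b_i,+\infty)\bigr).$$ For a positive integer $k$, $U_k=\{z\in\mathbb{C}: z^k=1\}$. $A=(A_i)_{i\in I}$ and $C=(C_{ij})_{(i,j)\in\mathbb{Z}_{\ge0}^2}$ are families of independent variables. A polynomial $Q\in\mathbb{C}[A]$ is called $U_n$-invariant if for every $\varepsilon\in U_n$ the substitution $A_i\mapsto\varepsilon^iA_i$ (for all $i\in I$) leaves $Q$ unchanged. The polynomials $F_{ij}\in\mathbb{C}[A]$ are defined by the identity $$\prod_{\varepsilon\in U_n}\Bigl(Y-\sum_{i\in I}A_i\varepsilon^iT^i\Bigr)=\sum_{(i,j)\in\mathbb{Z}_{\ge0}^2}F_{ij}\,T^{ni}Y^j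 ,$$ i.e. they express the coefficients $c_{ij}$ of the Weierstrass polynomial $f=\sum c_{ij}X^iY^j$ with $f(T^n,Y)=\prod_{\varepsilon\in U_n}(Y-\alpha(\varepsilon T))$ in terms of the coefficients $a_i$ of $\alpha=\sum_{i\in I}a_iT^i$. For $P\in\mathbb{C}[C]$, $P(F)\in\mathbb{C}[A]$ denotes the result of substituting $C_{ij}=F_{ij}$ for all $(i,j)$. *)

theory Defs
  imports
    "HOL-Analysis.Complex_Transcendental"
    "HOL-Library.Poly_Mapping"
    "HOL-Computational_Algebra.Polynomial"
    "HOL-Computational_Algebra.Formal_Power_Series"
    "HOL-Computational_Algebra.Fraction_Field"
begin

text \<open>
  Complex polynomials in variables indexed by a type, infinitely many being allowed. A monomial is
  a finitely supported exponent function, a polynomial a finitely supported family of coefficients.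
  The ring structure, integrality included, is the one of \<^theory>\<open>HOL-Library.Poly_Mapping\<close>.
\<close>

type_synonym 'v cpoly = "('v \<Rightarrow>\<^sub>0 nat) \<Rightarrow>\<^sub>0 complex"

definition Const :: "complex \<Rightarrow> 'v cpoly" where
  "Const c = Poly_Mapping.single 0 c"

definition Var :: "'v \<Rightarrow> 'v cpoly" where
  "Var v = Poly_Mapping.single (Poly_Mapping.single v 1) 1"

definition vars :: "'v cpoly \<Rightarrow> 'v set" where
  "vars p = (\<Union>u\<in>Poly_Mapping.keys p. Poly_Mapping.keys u)"

definition subst :: "('v \<Rightarrow> 'w cpoly) \<Rightarrow> 'v cpoly \<Rightarrow> 'w cpoly" where
  "subst s p = (\<Sum>u\<in>Poly_Mapping.keys p. Const (Poly_Mapping.lookup p u) *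
     (\<Prod>v\<in>Poly_Mapping.keys u. s v ^ Poly_Mapping.lookup u v))"

definition seq_gcd :: "(nat \<Rightarrow> nat) \<Rightarrow> nat \<Rightarrow> nat" where
  "seq_gcd b k = Gcd (b ` {..k})"

text \<open>
  Only the values \<open>b 0, \<dots>, b m\<close> matter. Note that \<open>b 0 < b 1\<close> is not required, and that \<open>m = 0\<close>
  is allowed (which forces \<open>b 0 = 1\<close>).
\<close>

definition characteristic_sequence :: "(nat \<Rightarrow> nat) \<Rightarrow> nat \<Rightarrow> bool" where
  "characteristic_sequence b m \<longleftrightarrow>
     (\<forall>k\<le>m. 0 < b k) \<and>
     strict_mono_on {1..m} b \<and>
     (\<forall>k<m. seq_gcd b (Suc k) < seq_gcd b k) \<and>
     seq_gcd b m = 1"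

definition index_set :: "(nat \<Rightarrow> nat) \<Rightarrow> nat \<Rightarrow> nat set" where
  "index_set b m = {seq_gcd b 0 * l |l. 0 < l} \<union>
     (\<Union>i\<in>{1..m}. {seq_gcd b i * l |l. True} \<inter> {b i..})"

definition unity_roots :: "nat \<Rightarrow> complex set" where
  "unity_roots k = {z. z ^ k = 1}"

text \<open>
  \<open>\<complex>[A]\<close> with \<open>A = (A\<^sub>i)\<close>, \<open>i \<in> I\<close>, is represented by the polynomials \<open>Q :: nat cpoly\<close> with
  \<open>vars Q \<subseteq> I\<close>.
\<close>

definition unity_invariant :: "nat \<Rightarrow> nat cpoly \<Rightarrow> bool" where
  "unity_invariant n Q \<longleftrightarrow>
     (\<forall>\<epsilon>\<in>unity_roots n. subst (\<lambda>i. Const (\<epsilon> ^ i) * Var i) Q = Q)"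

definition generic_series :: "nat set \<Rightarrow> complex \<Rightarrow> nat cpoly fps" where
  "generic_series I \<epsilon> = Abs_fps (\<lambda>i. if i \<in> I then Var i * Const (\<epsilon> ^ i) else 0)"

text \<open>
  The product over \<open>U\<^sub>n\<close> as a polynomial in \<open>Y\<close> over \<open>\<complex>[A][[T]]\<close>.
\<close>

definition weierstrass_product :: "nat \<Rightarrow> nat set \<Rightarrow> nat cpoly fps poly" where
  "weierstrass_product n I = (\<Prod>\<epsilon>\<in>unity_roots n. [:- generic_series I \<epsilon>, 1:])"

definition weierstrass_coeff :: "nat \<Rightarrow> nat set \<Rightarrow> nat \<times> nat \<Rightarrow> nat cpoly" where
  "weierstrass_coeff n I = (\<lambda>(i, j). fps_nth (poly.coeff (weierstrass_product n I) j) (n * i))"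

lemma twisted_product_nth:
  fixes \<omega> :: complex
  shows "fps_nth (poly.coeff (\<Prod>\<epsilon>\<in>S. [:- generic_series I (\<omega> * \<epsilon>), 1:]) j) k =
    Const (\<omega> ^ k) * fps_nth (poly.coeff (\<Prod>\<epsilon>\<in>S. [:- generic_series I \<epsilon>, 1:]) j) k"
proof (induction S arbitrary: j k rule: infinite_finite_induct)
  case (infinite A)
  then show ?case by (cases j; cases k) (auto simp: Const_def)
next
  case empty
  then show ?case by (cases j; cases k) (auto simp: Const_def)
next
  case (insert x S)
  have Const_mult: "Const (a * b) = Const a * Const b" for a b :: complex
    by (simp add: Const_def mult_single)
  let ?p = "\<Prod>\<epsilon>\<in>S. [:- generic_series I \<epsilon>, 1:]"
  let ?q = "\<Prod>\<epsilon>\<in>S. [:- generic_series I (\<omega> * \<epsilon>), 1:]"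
  have gen: "fps_nth (generic_series I (\<omega> * x)) i =
      Const (\<omega> ^ i) * fps_nth (generic_series I x) i" for i
    by (simp add: generic_series_def power_mult_distrib Const_mult mult_ac)
  have conv: "fps_nth (generic_series I (\<omega> * x) * poly.coeff ?q l) k =
      Const (\<omega> ^ k) * fps_nth (generic_series I x * poly.coeff ?p l) k" for l k
  proof -
    have "fps_nth (generic_series I (\<omega> * x)) i * fps_nth (poly.coeff ?q l) (k - i) =
        Const (\<omega> ^ k) * (fps_nth (generic_series I x) i * fps_nth (poly.coeff ?p l) (k - i))"
      if "i \<le> k" for i
    proof -
      have "Const (\<omega> ^ k) = (Const (\<omega> ^ i) * Const (\<omega> ^ (k - i)) :: nat cpoly)"
        using that by (simp flip: Const_mult power_add)
      then show ?thesis
        unfolding gen insert.IH by (simp add: mult_ac)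
    qed
    then show ?thesis
      by (simp add: fps_mult_nth sum_distrib_left)
  qed
  have coeff_Y: "poly.coeff ([:- a, 1:] * r) j =
      - (a * poly.coeff r j) + (case j of 0 \<Rightarrow> 0 | Suc l \<Rightarrow> poly.coeff r l)"
    for a :: "nat cpoly fps" and r
    by (simp add: coeff_pCons split: nat.split)
  show ?case
    unfolding prod.insert[OF insert.hyps] coeff_Y
    by (cases j) (simp_all only: conv insert.IH nat.case fps_add_nth fps_neg_nth fps_zero_nth
      distrib_left mult_minus_right mult_zero_right)
qed

text \<open>
  Only powers of \<open>T\<^sup>n\<close> occur in the product, so that \<^const>\<open>weierstrass_coeff\<close> collects all of its
  coefficients.
\<close>

lemma weierstrass_product_nth:
  assumes "0 < n"
  shows "fps_nth (poly.coeff (weierstrass_product n I) j) k =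
    (if n dvd k then weierstrass_coeff n I (k div n, j) else 0)"
proof (cases "n dvd k")
  case True
  then show ?thesis by (simp add: weierstrass_coeff_def)
next
  case False
  define \<omega> where "\<omega> = exp (2 * of_real pi * \<i> * of_nat 1 / of_nat n)"
  have \<omega>n: "\<omega> ^ n = 1"
    unfolding \<omega>_def using assms by (intro complex_root_unity) auto
  have \<omega>0: "\<omega> \<noteq> 0" by (simp add: \<omega>_def)
  have "\<omega> ^ k = exp (2 * of_real pi * \<i> * of_nat k / of_nat n)"
    by (simp add: \<omega>_def mult_ac flip: exp_of_nat_mult)
  then have \<omega>k: "\<omega> ^ k \<noteq> 1"
    using False assms complex_root_unity_eq_1[of n k] by simp
  let ?x = "fps_nth (poly.coeff (weierstrass_product n I) j) k"
  have "bij_betw ((*) \<omega>) (unity_roots n) (unity_roots n)"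
    by (rule bij_betw_byWitness[where f' = "\<lambda>z. z / \<omega>"])
       (auto simp: unity_roots_def \<omega>n \<omega>0 power_mult_distrib power_divide)
  then have "weierstrass_product n I =
      (\<Prod>\<epsilon>\<in>unity_roots n. [:- generic_series I (\<omega> * \<epsilon>), 1:])"
    unfolding weierstrass_product_def by (rule prod.reindex_bij_betw[symmetric])
  then have "?x = Const (\<omega> ^ k) * ?x"
    by (metis twisted_product_nth weierstrass_product_def)
  then have "(1 - Const (\<omega> ^ k)) * ?x = 0"
    by (simp add: left_diff_distrib)
  moreover have "1 - Const (\<omega> ^ k) \<noteq> (0 :: nat cpoly)"
    using \<omega>k by (metis Const_def eq_iff_diff_eq_0 lookup_single_eq lookup_one_zero)
  ultimately show ?thesis
    using False by simp
qed

end

theory Submission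
  imports Defs "HOL-Computational_Algebra.Fundamental_Theorem_Algebra"
begin

text \<open>
  Let \<open>R = \<complex>[F]\<close>, let \<open>\<alpha> = \<Sum> A\<^sub>i T\<^sup>i\<close>, write \<open>e\<^sub>k\<close> for the gcd of \<open>b\<^sub>0, \<dots>, b\<^sub>k\<close>, and give \<open>A\<^sub>i\<close> the weight \<open>i\<close>.
  An invariant polynomial is a combination of monomials whose weight is divisible by \<open>n\<close>. So one has to
  find, for such a \<open>Q\<close>, a monomial \<open>V\<close> in the \<open>A\<^bsub>b\<^sub>l\<^esub>\<close> with \<open>V \<in> R\<close> and \<open>V Q \<in> R\<close>.

  Fix \<open>k \<le> m\<close>. Call a polynomial \<open>p\<close> graded of weight \<open>w\<close> at level \<open>k\<close> if \<open>\<nu> p \<in> R\<close> for some monomial \<open>\<nu>\<close> in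
  \<open>A\<^bsub>b\<^sub>1\<^esub>, \<dots>, A\<^bsub>b\<^sub>k\<^esub>\<close> that has weight \<open>- w\<close> modulo \<open>n\<close>. These sets are the homogeneous parts of a ring as soon
  as the monomials of weight \<open>0\<close> in the same variables become units once the monomials that belong to
  \<open>R\<close> are inverted (\<open>invertible_weight_0 k\<close>). The theorem follows if this holds at level \<open>m\<close> and all
  \<open>A\<^sub>i\<close> are graded of weight \<open>i\<close> there.

  Both facts are proved by induction on the level and, within a level, on \<open>i\<close>. Let \<open>i\<close> lie above \<open>b\<^sub>k\<close>,
  if \<open>k \<ge> 1\<close>, and be at most \<open>b\<^bsub>k+1\<^esub>\<close>, if \<open>k < m\<close>. Let \<open>\<beta>\<close> be the part of \<open>\<alpha>\<close> below \<open>T\<^sup>i\<close>. The difference \<open>\<beta>(T) - \<alpha>(\<epsilon>T)\<close> has leading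
  term \<open>- \<epsilon>\<^sup>i A\<^sub>i T\<^sup>i\<close> for the \<open>e\<^sub>k\<close>-th roots of unity \<open>\<epsilon>\<close>, and the leading term \<open>(1 - \<epsilon>\<^bsup>b\<^sub>l\<^esup>) A\<^bsub>b\<^sub>l\<^esub> T\<^bsup>b\<^sub>l\<^esup>\<close> of
  smaller order, with \<open>l \<le> k\<close>, for the others. Hence in
  \<open>f(\<beta> + Z) = \<Prod> (Z + \<beta>(T) - \<alpha>(\<epsilon>T))\<close> the terms of lowest order, when \<open>Z\<close> is counted like \<open>T\<^sup>i\<close>, form the
  product of \<open>\<Prod> (Z - \<epsilon>\<^sup>i A\<^sub>i T\<^sup>i)\<close>, over the \<open>e\<^sub>k\<close>-th roots of unity, with a nonzero multiple of a
  monomial in \<open>A\<^bsub>b\<^sub>1\<^esub>, \<dots>, A\<^bsub>b\<^sub>k\<^esub>\<close>. Since \<open>\<Prod> (Z - \<epsilon>\<^sup>i) = (Z\<^sup>d - 1)\<^sup>g\<close> with \<open>g = gcd e\<^sub>k i\<close> and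
  \<open>d = e\<^sub>k / g\<close>, one coefficient of \<open>f(\<beta> + Z)\<close> is such a monomial times a nonzero multiple of \<open>A\<^sub>i\<^sup>d\<close>
  (\<open>leading_coefficient\<close>). The same coefficient is a polynomial in the \<open>F\<^sub>i\<^sub>j\<close> and in the variables before
  \<open>A\<^sub>i\<close>, so it is graded, and \<open>A\<^sub>i\<^sup>d\<close> is graded of weight \<open>i d\<close> (\<open>graded_Var_power\<close>).

  If \<open>i < b\<^bsub>k+1\<^esub>\<close> or \<open>k = m\<close>, then \<open>e\<^sub>k\<close> divides \<open>i\<close>, so \<open>d = 1\<close>. If \<open>i = b\<^bsub>k+1\<^esub>\<close>, then \<open>d = e\<^sub>k / e\<^bsub>k+1\<^esub>\<close>, and this is just
  the power needed to pass to level \<open>k + 1\<close>: the exponent of \<open>A\<^bsub>b\<^sub>k\<^sub>+\<^sub>1\<^esub>\<close> in a monomial of weight \<open>0\<close> is a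
  multiple of \<open>d\<close> (\<open>invertible_weight_0_Suc\<close>).
\<close>

section \<open>Evaluation of polynomials in arbitrarily many variables\<close>

lemma Const_0: "Const 0 = 0"
  and Const_1: "Const 1 = 1"
  and Const_add: "Const (c + d) = Const c + Const d"
  and Const_uminus: "Const (- c) = - Const c"
  and Const_diff: "Const (c - d) = Const c - Const d"
  and Const_mult: "Const (c * d) = Const c * Const d"
  by (simp_all add: Const_def single_add single_uminus single_diff mult_single)

lemma Const_power: "Const (c ^ k) = Const c ^ k"
  by (induction k) (simp_all add: Const_1 Const_mult)

lemma Const_prod: "Const (\<Prod>x\<in>S. c x) = (\<Prod>x\<in>S. Const (c x))"
  by (induction S rule: infinite_finite_induct) (simp_all add: Const_1 Const_mult)

lemma Var_nonzero: "Var v \<noteq> 0"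
  unfolding Var_def by (metis lookup_single_eq lookup_zero zero_neq_one)

definition monomial_value :: "('v \<Rightarrow> 'w cpoly) \<Rightarrow> ('v \<Rightarrow>\<^sub>0 nat) \<Rightarrow> 'w cpoly" where
  "monomial_value s u = (\<Prod>v\<in>Poly_Mapping.keys u. s v ^ Poly_Mapping.lookup u v)"

lemma monomial_value_superset:
  assumes "finite S" "Poly_Mapping.keys u \<subseteq> S"
  shows "monomial_value s u = (\<Prod>v\<in>S. s v ^ Poly_Mapping.lookup u v)"
  unfolding monomial_value_def
  by (rule prod.mono_neutral_left) (use assms in \<open>auto simp: in_keys_iff\<close>)

lemma monomial_value_add: "monomial_value s (u + v) = monomial_value s u * monomial_value s v"
proof -
  let ?S = "Poly_Mapping.keys u \<union> Poly_Mapping.keys v"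
  have "Poly_Mapping.keys (u + v) \<subseteq> ?S" by (rule keys_add)
  then show ?thesis
    by (simp add: monomial_value_superset[of ?S] lookup_add power_add prod.distrib)
qed

lemma subst_superset:
  assumes "finite S" "Poly_Mapping.keys p \<subseteq> S"
  shows "subst s p = (\<Sum>u\<in>S. Const (Poly_Mapping.lookup p u) * monomial_value s u)"
  unfolding subst_def monomial_value_def[symmetric]
  by (rule sum.mono_neutral_left) (use assms in \<open>auto simp: in_keys_iff Const_0\<close>)

lemma subst_add: "subst s (p + q) = subst s p + subst s q"
proof -
  let ?S = "Poly_Mapping.keys p \<union> Poly_Mapping.keys q"
  have "Poly_Mapping.keys (p + q) \<subseteq> ?S" by (rule keys_add)
  then show ?thesis
    by (simp add: subst_superset[of ?S] lookup_add Const_add distrib_right sum.distrib)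
qed

lemma subst_single: "subst s (Poly_Mapping.single u c) = Const c * monomial_value s u"
  by (subst subst_superset[of "{u}"]) auto

lemma subst_0: "subst s 0 = 0"
  by (simp add: subst_def)

lemma subst_sum: "subst s (\<Sum>x\<in>S. p x) = (\<Sum>x\<in>S. subst s (p x))"
  by (induction S rule: infinite_finite_induct) (simp_all add: subst_0 subst_add)

lemma sum_singles:
  "p = (\<Sum>u\<in>Poly_Mapping.keys p. Poly_Mapping.single u (Poly_Mapping.lookup p u))"
  by (rule poly_mapping_eqI)
    (simp add: lookup_sum lookup_single when_def in_keys_iff sum.delta' sum.delta)

lemma subst_mult: "subst s (p * q) = subst s p * subst s q"
proof -
  let ?x = "\<lambda>u. Poly_Mapping.single u (Poly_Mapping.lookup p u)"
  let ?y = "\<lambda>u. Poly_Mapping.single u (Poly_Mapping.lookup q u)"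
  have single: "subst s (?x u * ?y v) = subst s (?x u) * subst s (?y v)" for u v
    by (simp add: mult_single subst_single Const_mult monomial_value_add mult_ac)
  have "p * q = (\<Sum>u\<in>Poly_Mapping.keys p. \<Sum>v\<in>Poly_Mapping.keys q. ?x u * ?y v)"
    by (subst sum_singles[of p], subst sum_singles[of q]) (simp add: sum_product)
  also have "subst s \<dots> = (\<Sum>u\<in>Poly_Mapping.keys p. subst s (?x u)) *
      (\<Sum>v\<in>Poly_Mapping.keys q. subst s (?y v))"
    by (simp add: subst_sum single sum_product)
  also have "\<dots> = subst s p * subst s q"
    by (simp flip: subst_sum sum_singles)
  finally show ?thesis .
qed

lemma monomial_value_Var: "monomial_value Var u = Poly_Mapping.single u 1"
proof -
  have pow: "Var v ^ k = Poly_Mapping.single (Poly_Mapping.single v k) 1" for v :: 'a and k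
    by (induction k) (simp_all add: Var_def mult_single single_add[symmetric])
  have "(\<Prod>v\<in>S. Poly_Mapping.single (f v) (1::complex)) = Poly_Mapping.single (\<Sum>v\<in>S. f v) 1"
    for S and f :: "'a \<Rightarrow> 'a \<Rightarrow>\<^sub>0 nat"
    by (induction S rule: infinite_finite_induct) (simp_all add: mult_single)
  then show ?thesis
    by (simp add: monomial_value_def pow flip: sum_singles)
qed

lemma subst_Const: "subst s (Const c) = Const c"
  unfolding Const_def[of c] subst_single by (simp add: monomial_value_def Const_def)

lemma subst_Var: "subst s (Var v) = s v"
  by (simp add: Var_def subst_single monomial_value_def Const_1)

definition weight :: "(nat \<Rightarrow>\<^sub>0 nat) \<Rightarrow> nat" where
  "weight u = (\<Sum>i\<in>Poly_Mapping.keys u. i * Poly_Mapping.lookup u i)"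

lemma exists_primitive_root:
  assumes "0 < n"
  obtains \<omega> :: complex where "\<omega> ^ n = 1" "\<And>k. \<omega> ^ k = 1 \<Longrightarrow> n dvd k"
proof
  let ?\<omega> = "exp (2 * of_real pi * \<i> * of_nat 1 / of_nat n) :: complex"
  show "?\<omega> ^ n = 1" using assms by (intro complex_root_unity) auto
  fix k
  assume "?\<omega> ^ k = 1"
  moreover have "?\<omega> ^ k = exp (2 * of_real pi * \<i> * of_nat k / of_nat n)"
    by (simp add: mult_ac flip: exp_of_nat_mult)
  ultimately show "n dvd k"
    using assms complex_root_unity_eq_1[of n k] by simp
qed

text \<open>
  A primitive \<open>n\<close>-th root of unity \<open>\<omega>\<close> acts on a monomial of weight \<open>w\<close> by the factor \<open>\<omega>\<^sup>w\<close>.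
\<close>

lemma unity_invariant_imp_weight:
  assumes "unity_invariant n Q" "0 < n" "u \<in> Poly_Mapping.keys Q"
  shows "n dvd weight u"
proof -
  obtain \<omega> :: complex where \<omega>: "\<omega> ^ n = 1" "\<And>k. \<omega> ^ k = 1 \<Longrightarrow> n dvd k"
    using exists_primitive_root[OF assms(2)] by blast
  let ?s = "\<lambda>i. Const (\<omega> ^ i) * Var i"
  have twisted: "monomial_value ?s v = Poly_Mapping.single v (\<omega> ^ weight v)" for v
  proof -
    have "monomial_value ?s v = Const (\<omega> ^ weight v) * monomial_value Var v"
      by (simp add: monomial_value_def power_mult_distrib prod.distrib weight_def power_sum
        Const_prod power_mult flip: Const_power)
    then show ?thesis
      by (simp add: monomial_value_Var Const_def mult_single)
  qed
  have "Q = subst ?s Q"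
    using assms(1) \<omega>(1) by (simp add: unity_invariant_def unity_roots_def)
  also have "\<dots> = (\<Sum>v\<in>Poly_Mapping.keys Q.
      Poly_Mapping.single v (Poly_Mapping.lookup Q v * \<omega> ^ weight v))"
    by (subst subst_superset[OF finite_keys order_refl]) (simp only: twisted, simp add: Const_def mult_single)
  finally have "Poly_Mapping.lookup Q u = Poly_Mapping.lookup (\<Sum>v\<in>Poly_Mapping.keys Q.
      Poly_Mapping.single v (Poly_Mapping.lookup Q v * \<omega> ^ weight v)) u"
    by (rule arg_cong)
  also have "\<dots> = Poly_Mapping.lookup Q u * \<omega> ^ weight u"
    using assms(3) by (simp add: lookup_sum lookup_single when_def)
  finally have "Poly_Mapping.lookup Q u = Poly_Mapping.lookup Q u * \<omega> ^ weight u" .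
  with assms(3) have "\<omega> ^ weight u = 1"
    by (simp add: in_keys_iff)
  then show ?thesis by (rule \<omega>(2))
qed

section \<open>Products over roots of unity\<close>

lemma coeff_linear_factor_mult:
  "poly.coeff ([:a, t:] * p) j =
    a * poly.coeff p j + (case j of 0 \<Rightarrow> 0 | Suc l \<Rightarrow> t * poly.coeff p l)"
  for a t :: "'a :: comm_ring_1"
  by (simp add: coeff_pCons split: nat.split)

lemma unity_roots_gcd:
  assumes "0 < a"
  shows "unity_roots (gcd a k) = {z \<in> unity_roots a. z ^ k = 1}"
proof (intro subset_antisym subsetI)
  fix z :: complex
  assume "z \<in> unity_roots (gcd a k)"
  moreover obtain a' k' where "a = gcd a k * a'" "k = gcd a k * k'"
    by (meson dvdE gcd_dvd1 gcd_dvd2)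
  ultimately show "z \<in> {z \<in> unity_roots a. z ^ k = 1}"
    unfolding unity_roots_def by (metis (mono_tags, lifting) mem_Collect_eq power_mult power_one)
next
  fix z :: complex
  assume "z \<in> {z \<in> unity_roots a. z ^ k = 1}"
  then have z: "z ^ a = 1" "z ^ k = 1" by (auto simp: unity_roots_def)
  obtain x y where "a * x = k * y + gcd a k"
    using bezout_nat[of a k] assms by blast
  then have "(z ^ a) ^ x = (z ^ k) ^ y * z ^ gcd a k"
    by (metis power_add power_mult)
  with z show "z \<in> unity_roots (gcd a k)" by (simp add: unity_roots_def)
qed

lemma finite_unity_roots: "0 < e \<Longrightarrow> finite (unity_roots e)"
  unfolding unity_roots_def by (rule finite_roots_unity) simp

lemma card_unity_roots: "0 < e \<Longrightarrow> card (unity_roots e) = e"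
  unfolding unity_roots_def by (rule card_roots_unity_eq)

lemma prod_unity_roots:
  assumes "0 < d"
  shows "(\<Prod>y\<in>unity_roots d. [:- y, 1:]) = monom 1 d - 1"
proof -
  let ?p = "monom 1 d - 1 :: complex poly"
  have roots: "{z. poly ?p z = 0} = unity_roots d"
    by (simp add: unity_roots_def poly_monom)
  have "rsquarefree ?p"
    unfolding rsquarefree_roots
    using assms by (auto simp: poly_monom pderiv_diff pderiv_monom power_0_left)
  then have "smult (lead_coeff ?p) (\<Prod>z|poly ?p z = 0. [:- z, 1:]) = ?p"
    by (rule complex_poly_decompose_rsquarefree)
  moreover have "degree ?p = d"
    using assms by (subst diff_conv_add_uminus, subst degree_add_eq_left) (simp_all add: degree_monom_eq)
  then have "lead_coeff ?p = 1" using assms by simp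
  ultimately show ?thesis by (metis roots smult_1_left)
qed

lemma coeff_pcompose_monom:
  fixes p :: "'a :: comm_ring_1 poly"
  assumes "0 < d"
  shows "poly.coeff (pcompose p (monom 1 d)) (d * t) = poly.coeff p t"
proof (induction p arbitrary: t)
  case (pCons a p)
  show ?case
  proof (cases t)
    case 0
    with assms show ?thesis by (simp add: pcompose_pCons coeff_monom_mult)
  next
    case (Suc r)
    have "d * Suc r - d = d * r" by simp
    with Suc assms pCons.IH[of r] show ?thesis
      by (auto simp: pcompose_pCons coeff_monom_mult coeff_pCons split: nat.split)
  qed
qed simp

text \<open>
  The map \<open>\<epsilon> \<mapsto> \<epsilon>\<^sup>i\<close> sends \<open>U\<^sub>e\<close> onto \<open>U\<^sub>d\<close> with fibres of size \<open>g\<close>, by counting the elements of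
  \<open>U\<^sub>e\<close>.
\<close>

lemma prod_unity_root_powers:
  fixes e i :: nat
  defines "g \<equiv> gcd e i"
  defines "d \<equiv> e div g"
  assumes "0 < e"
  shows "(\<Prod>\<epsilon>\<in>unity_roots e. [:- (\<epsilon> ^ i), 1:]) = (monom 1 d - 1) ^ g"
proof -
  let ?h = "\<lambda>\<epsilon>::complex. \<epsilon> ^ i"
  let ?U = "unity_roots e"
  have g: "0 < g" "e = d * g" and d: "0 < d"
    using assms by (simp_all add: g_def d_def div_greater_zero_iff gcd_le1_nat)
  have fin: "finite ?U" using assms(3) by (rule finite_unity_roots)
  have fibre: "card {\<epsilon>\<in>?U. ?h \<epsilon> = y} = g" if "y \<in> ?h ` ?U" for y
  proof -
    from that obtain \<epsilon>\<^sub>0 where e0: "\<epsilon>\<^sub>0 \<in> ?U" "y = \<epsilon>\<^sub>0 ^ i" by auto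
    then have nz: "\<epsilon>\<^sub>0 \<noteq> 0" "\<epsilon>\<^sub>0 ^ e = 1"
      using assms(3) by (auto simp: unity_roots_def power_0_left)
    have "bij_betw ((*) \<epsilon>\<^sub>0) (unity_roots g) {\<epsilon>\<in>?U. ?h \<epsilon> = y}"
      unfolding g_def unity_roots_gcd[OF assms(3)]
      by (rule bij_betw_byWitness[where f' = "\<lambda>z. z / \<epsilon>\<^sub>0"])
        (use nz e0 in \<open>auto simp: unity_roots_def power_mult_distrib power_divide\<close>)
    then show ?thesis
      using card_unity_roots[OF g(1)] bij_betw_same_card by metis
  qed
  have "e = (\<Sum>\<epsilon>\<in>?U. 1)" using card_unity_roots[OF assms(3)] by simp
  also have "\<dots> = (\<Sum>y\<in>?h ` ?U. \<Sum>\<epsilon>\<in>{\<epsilon>\<in>?U. ?h \<epsilon> = y}. 1)"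
    by (rule sum.image_gen[OF fin])
  also have "\<dots> = card (?h ` ?U) * g" by (simp add: fibre)
  finally have card: "card (?h ` ?U) = d" using g by simp
  have img: "?h ` ?U = unity_roots d"
  proof (rule card_subset_eq)
    show "?h ` ?U \<subseteq> unity_roots d"
    proof
      fix y
      assume "y \<in> ?h ` ?U"
      then obtain \<epsilon> where e: "\<epsilon> ^ e = 1" "y = \<epsilon> ^ i" by (auto simp: unity_roots_def)
      have "i * d = e * (i div g)"
        using g by (metis dvd_div_mult_self g_def gcd_dvd2 mult.assoc mult.commute)
      with e show "y \<in> unity_roots d"
        by (simp add: unity_roots_def) (metis power_mult power_one)
    qed
  qed (use d card in \<open>simp_all add: finite_unity_roots card_unity_roots\<close>)
  have "(\<Prod>\<epsilon>\<in>?U. [:- (\<epsilon> ^ i), 1:]) = (\<Prod>y\<in>?h ` ?U. \<Prod>\<epsilon>\<in>{\<epsilon>\<in>?U. ?h \<epsilon> = y}. [:- (\<epsilon> ^ i), 1:])"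
    by (rule prod.image_gen[OF fin])
  also have "\<dots> = (\<Prod>y\<in>?h ` ?U. [:- y, 1:] ^ g)"
  proof (intro prod.cong refl)
    fix y
    assume "y \<in> ?h ` ?U"
    have "(\<Prod>\<epsilon>\<in>{\<epsilon>\<in>?U. ?h \<epsilon> = y}. [:- (\<epsilon> ^ i), 1:]) = (\<Prod>\<epsilon>\<in>{\<epsilon>\<in>?U. ?h \<epsilon> = y}. [:- y, 1:])"
      by (rule prod.cong) auto
    with fibre[OF \<open>y \<in> ?h ` ?U\<close>]
    show "(\<Prod>\<epsilon>\<in>{\<epsilon>\<in>?U. ?h \<epsilon> = y}. [:- (\<epsilon> ^ i), 1:]) = [:- y, 1:] ^ g"
      by simp
  qed
  also have "\<dots> = (monom 1 d - 1) ^ g"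
    by (simp add: img prod_power_distrib[symmetric] prod_unity_roots[OF d])
  finally show ?thesis .
qed

text \<open>
  The second highest nonzero coefficient of \<open>(Z\<^sup>d - 1)\<^sup>g\<close>: it belongs to \<open>Z\<^bsup>d(g-1)\<^esup>\<close>, and \<open>d (g - 1) = e - d\<close>.
\<close>

lemma coeff_prod_unity_root_powers:
  fixes e i :: nat
  defines "d \<equiv> e div gcd e i"
  assumes "0 < e"
  shows "poly.coeff (\<Prod>\<epsilon>\<in>unity_roots e. [:- (\<epsilon> ^ i), 1:]) (e - d) = - of_nat (gcd e i)"
proof -
  let ?g = "gcd e i"
  have g: "0 < ?g" "e = d * ?g" and d: "0 < d"
    using assms by (simp_all add: d_def div_greater_zero_iff gcd_le1_nat)
  have "monom 1 d - 1 = pcompose [:- 1, 1:] (monom 1 d :: complex poly)"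
    by (simp add: pcompose_pCons one_pCons)
  moreover have "pcompose p q ^ k = pcompose (p ^ k) q" for p q :: "complex poly" and k
    by (induction k) (simp_all add: pcompose_1 pcompose_mult)
  ultimately have "(monom 1 d - 1) ^ ?g = pcompose ([:- 1, 1:] ^ ?g) (monom 1 d :: complex poly)"
    by simp
  moreover have "e - d = d * (?g - 1)"
    using g by (metis diff_mult_distrib2 mult.right_neutral)
  ultimately have "poly.coeff ((monom 1 d - 1) ^ ?g :: complex poly) (e - d) =
      poly.coeff ([:- 1, 1:] ^ ?g) (?g - 1)"
    by (simp add: coeff_pcompose_monom[OF d])
  also have "\<dots> = - of_nat ?g"
  proof -
    obtain t where "?g = Suc t" using g(1) gr0_implies_Suc by blast
    then show ?thesis by (subst coeff_linear_poly_power) simp_all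
  qed
  finally show ?thesis
    using prod_unity_root_powers[OF assms(2), of i] by (simp add: d_def)
qed

text \<open>
  This transports a product over roots of unity to the same product scaled by a variable. Multiplying by \<open>a\<^sup>s\<close> on the
  left, instead of writing \<open>a\<close> to the power \<open>card S - s\<close> on the right, keeps the formula true for
  every \<open>s\<close>.
\<close>

lemma coeff_prod_homogeneous:
  fixes a :: "'v cpoly"
  shows "poly.coeff (\<Prod>x\<in>S. [:- (Const (c x) * a), 1:]) s * a ^ s =
    Const (poly.coeff (\<Prod>x\<in>S. [:- c x, 1:]) s) * a ^ card S"
proof (induction S arbitrary: s rule: infinite_finite_induct)
  case (insert x S)
  let ?p = "\<Prod>x\<in>S. [:- (Const (c x) * a), 1:]" and ?q = "\<Prod>x\<in>S. [:- c x, 1:]"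
  have shifted: "(case s of 0 \<Rightarrow> 0 | Suc l \<Rightarrow> 1 * poly.coeff ?p l) * a ^ s =
      Const (case s of 0 \<Rightarrow> 0 | Suc l \<Rightarrow> 1 * poly.coeff ?q l) * a ^ Suc (card S)"
  proof (cases s)
    case (Suc l)
    have "poly.coeff ?p l * a ^ Suc l = a * (poly.coeff ?p l * a ^ l)" by (simp add: mult_ac)
    with Suc show ?thesis unfolding insert.IH by (simp add: mult_ac)
  qed (simp add: Const_0)
  have "- (Const (c x) * a) * poly.coeff ?p s * a ^ s =
      - Const (c x) * a * (poly.coeff ?p s * a ^ s)"
    by (simp add: mult_ac)
  also have "\<dots> = Const (- c x * poly.coeff ?q s) * a ^ Suc (card S)"
    unfolding insert.IH by (simp add: Const_mult Const_uminus mult_ac)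
  finally show ?case
    unfolding prod.insert[OF insert.hyps] coeff_linear_factor_mult card_insert_disjoint[OF insert.hyps]
      Const_add distrib_right shifted by simp
qed (auto simp: Const_0 Const_1 coeff_1)

lemma nth_coeff_prod_linear:
  fixes h :: "'b \<Rightarrow> 'a :: comm_ring_1 fps"
  shows "fps_nth (poly.coeff (\<Prod>x\<in>S. [:h x, t x:]) s) 0 =
    poly.coeff (\<Prod>x\<in>S. [:fps_nth (h x) 0, fps_nth (t x) 0:]) s"
proof (induction S arbitrary: s rule: infinite_finite_induct)
  case (insert x S)
  then show ?case
    unfolding prod.insert[OF insert.hyps] coeff_linear_factor_mult
    by (cases s) simp_all
qed (auto simp: coeff_1)

section \<open>The grading by monomials in the characteristic variables\<close>

locale char_seq =
  fixes b :: "nat \<Rightarrow> nat" and m :: nat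
  assumes characteristic: "characteristic_sequence b m"
begin

abbreviation "n \<equiv> b 0"
abbreviation "e \<equiv> seq_gcd b"
abbreviation "I \<equiv> index_set b m"
abbreviation "F \<equiv> weierstrass_coeff n I"

lemma n_pos: "0 < n"
  and b_less: "1 \<le> j \<Longrightarrow> j < k \<Longrightarrow> k \<le> m \<Longrightarrow> b j < b k"
  using characteristic by (auto simp: characteristic_sequence_def strict_mono_on_def)

lemma b_le: "1 \<le> j \<Longrightarrow> j \<le> k \<Longrightarrow> k \<le> m \<Longrightarrow> b j \<le> b k"
  using b_less[of j k] by (cases "j = k") auto

lemma gcd_0: "e 0 = n"
  by (simp add: seq_gcd_def)

lemma gcd_Suc: "e (Suc k) = gcd (e k) (b (Suc k))"
  by (simp add: seq_gcd_def atMost_Suc gcd.commute)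

lemma gcd_dvd_gcd: "j \<le> k \<Longrightarrow> e k dvd e j"
  unfolding seq_gcd_def by (rule Gcd_greatest) (auto intro: Gcd_dvd)

lemma gcd_dvd_b: "j \<le> k \<Longrightarrow> e k dvd b j"
  unfolding seq_gcd_def by (rule Gcd_dvd) auto

lemma gcd_pos: "0 < e k"
  using gcd_dvd_b[of 0 k] n_pos by (auto intro: dvd_pos_nat)

lemma b_in_index:
  assumes "l \<in> {1..m}"
  shows "b l \<in> I"
proof -
  from gcd_dvd_b[of l l] obtain q where "b l = e l * q" by (auto elim: dvdE)
  with assms show ?thesis by (auto simp: index_set_def)
qed

text \<open>
  Indices that are not divisible by \<open>e\<^sub>k\<close> come from a later part of the index set, which starts at
  \<open>b\<^bsub>k+1\<^esub>\<close> or beyond.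
\<close>

lemma gcd_dvd_index:
  assumes "i \<in> I" "k \<le> m" "k < m \<Longrightarrow> i < b (Suc k)"
  shows "e k dvd i"
proof -
  from assms(1) consider "e 0 dvd i" | t where "t \<in> {1..m}" "e t dvd i" "b t \<le> i"
    by (auto simp: index_set_def)
  then show ?thesis
  proof cases
    case 1
    then show ?thesis using gcd_dvd_gcd[of 0 k] by (meson dvd_trans le0)
  next
    case 2
    have "t \<le> k"
    proof (rule ccontr)
      assume "\<not> t \<le> k"
      with 2(1) have "k < m" "b (Suc k) \<le> b t" by (auto intro: b_le)
      with assms(3) 2(3) show False by simp
    qed
    then show ?thesis using gcd_dvd_gcd 2(2) by (meson dvd_trans)
  qed
qed

definition coeff_ring :: "nat cpoly set" where
  "coeff_ring = range (subst F)"

lemma ring_Const: "Const c \<in> coeff_ring"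
  and ring_F: "F ij \<in> coeff_ring"
  unfolding coeff_ring_def by (metis rangeI subst_Const, metis rangeI subst_Var)

lemma ring_mult: "p \<in> coeff_ring \<Longrightarrow> q \<in> coeff_ring \<Longrightarrow> p * q \<in> coeff_ring"
  unfolding coeff_ring_def by (metis (mono_tags, lifting) rangeE rangeI subst_mult)

lemma ring_add: "p \<in> coeff_ring \<Longrightarrow> q \<in> coeff_ring \<Longrightarrow> p + q \<in> coeff_ring"
  unfolding coeff_ring_def by (metis (mono_tags, lifting) rangeE rangeI subst_add)

lemma ring_0: "0 \<in> coeff_ring" and ring_1: "1 \<in> coeff_ring"
  using ring_Const[of 0] ring_Const[of 1] by (simp_all add: Const_0 Const_1)

text \<open>
  The weight is an argument of its own, rather than a function of the polynomial \<open>x\<close>, so that it need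
  not be read off from \<open>x\<close>.
\<close>

definition b_monomial :: "nat \<Rightarrow> nat cpoly \<Rightarrow> nat \<Rightarrow> bool" where
  "b_monomial k x w \<longleftrightarrow>
    (\<exists>d. x = (\<Prod>l\<in>{1..k}. Var (b l) ^ d l) \<and> w = (\<Sum>l\<in>{1..k}. d l * b l))"

lemma b_monomial_1: "b_monomial k 1 0"
  unfolding b_monomial_def by (rule exI[of _ "\<lambda>_. 0"]) simp

lemma b_monomial_mult:
  assumes "b_monomial k x w" "b_monomial k x' w'"
  shows "b_monomial k (x * x') (w + w')"
proof -
  from assms obtain d d' where
    "x = (\<Prod>l\<in>{1..k}. Var (b l) ^ d l)" "w = (\<Sum>l\<in>{1..k}. d l * b l)"
    "x' = (\<Prod>l\<in>{1..k}. Var (b l) ^ d' l)" "w' = (\<Sum>l\<in>{1..k}. d' l * b l)"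
    unfolding b_monomial_def by blast
  then show ?thesis
    unfolding b_monomial_def
    by (intro exI[of _ "\<lambda>l. d l + d' l"])
      (simp add: power_add prod.distrib distrib_right sum.distrib)
qed

lemma b_monomial_power: "b_monomial k x w \<Longrightarrow> b_monomial k (x ^ r) (r * w)"
  by (induction r) (auto simp: b_monomial_1 intro: b_monomial_mult)

lemma b_monomial_prod:
  "(\<And>x. x \<in> S \<Longrightarrow> b_monomial k (f x) (w x)) \<Longrightarrow> b_monomial k (\<Prod>x\<in>S. f x) (\<Sum>x\<in>S. w x)"
  by (induction S rule: infinite_finite_induct) (auto simp: b_monomial_1 intro: b_monomial_mult)

lemma b_monomial_Var:
  assumes "l \<in> {1..k}"
  shows "b_monomial k (Var (b l)) (b l)"
proof -
  have "(\<Prod>j\<in>{1..k}. Var (b j) ^ (if j = l then 1 else 0)) =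
      (\<Prod>j\<in>{1..k}. if j = l then Var (b j) else 1 :: nat cpoly)"
    by (rule prod.cong) auto
  also have "\<dots> = Var (b l)" using assms by simp
  finally show ?thesis
    unfolding b_monomial_def using assms
    by (intro exI[of _ "\<lambda>j. if j = l then 1 else 0"]) (simp add: if_distrib[of "\<lambda>x. x * _"] cong: if_cong)
qed

lemma b_monomial_nonzero: "b_monomial k x w \<Longrightarrow> x \<noteq> 0"
  unfolding b_monomial_def by (auto simp: Var_nonzero)

lemma b_monomial_Suc_iff:
  "b_monomial (Suc k) x w \<longleftrightarrow>
    (\<exists>r y v. x = y * Var (b (Suc k)) ^ r \<and> w = v + r * b (Suc k) \<and> b_monomial k y v)"
proof
  assume "b_monomial (Suc k) x w"
  then show "\<exists>r y v. x = y * Var (b (Suc k)) ^ r \<and> w = v + r * b (Suc k) \<and> b_monomial k y v"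
    unfolding b_monomial_def by auto
next
  assume "\<exists>r y v. x = y * Var (b (Suc k)) ^ r \<and> w = v + r * b (Suc k) \<and> b_monomial k y v"
  then obtain r d where x: "x = (\<Prod>l\<in>{1..k}. Var (b l) ^ d l) * Var (b (Suc k)) ^ r"
    and w: "w = (\<Sum>l\<in>{1..k}. d l * b l) + r * b (Suc k)"
    unfolding b_monomial_def by blast
  have "x = (\<Prod>l\<in>{1..Suc k}. Var (b l) ^ (d(Suc k := r)) l)"
    "w = (\<Sum>l\<in>{1..Suc k}. (d(Suc k := r)) l * b l)"
    unfolding x w by (auto intro!: prod.cong sum.cong)
  then show "b_monomial (Suc k) x w"
    unfolding b_monomial_def by blast
qed

lemma b_monomial_Suc: "b_monomial k x w \<Longrightarrow> b_monomial (Suc k) x w"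
  unfolding b_monomial_Suc_iff by (intro exI[of _ 0] exI[of _ x] exI[of _ w]) simp

lemma gcd_dvd_weight: "b_monomial k x w \<Longrightarrow> e k dvd w"
  unfolding b_monomial_def by (auto intro!: dvd_sum dvd_mult gcd_dvd_b)

text \<open>
  The elements of weight \<open>w\<close> modulo \<open>n\<close> that lie in \<^term>\<open>coeff_ring\<close> up to a monomial denominator.
  The zero polynomial is included separately because there may be no monomial of weight \<open>- w\<close>: the
  weights of the monomials at level \<open>k\<close> are all divisible by \<open>e\<^sub>k\<close>.
\<close>

definition graded :: "nat \<Rightarrow> nat \<Rightarrow> nat cpoly set" where
  "graded k w =
    {p. p = 0 \<or> (\<exists>\<nu> v. b_monomial k \<nu> v \<and> n dvd v + w \<and> \<nu> * p \<in> coeff_ring)}"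

text \<open>
  Such an \<open>x\<close> is the unit \<open>\<nu> x / \<nu>\<close> after the monomials in \<^term>\<open>coeff_ring\<close> are inverted.
\<close>

definition invertible_weight_0 :: "nat \<Rightarrow> bool" where
  "invertible_weight_0 k \<longleftrightarrow> (\<forall>x w. b_monomial k x w \<and> n dvd w \<longrightarrow>
    (\<exists>\<nu> v. b_monomial k \<nu> v \<and> n dvd v \<and> \<nu> \<in> coeff_ring \<and> \<nu> * x \<in> coeff_ring))"

lemma gradedI: "b_monomial k \<nu> v \<Longrightarrow> n dvd v + w \<Longrightarrow> \<nu> * p \<in> coeff_ring \<Longrightarrow> p \<in> graded k w"
  unfolding graded_def by blast

lemma gradedE:
  assumes "p \<in> graded k w" "p \<noteq> 0"
  obtains \<nu> v where "b_monomial k \<nu> v" "n dvd v + w" "\<nu> * p \<in> coeff_ring"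
  using assms unfolding graded_def by blast

lemma graded_0: "0 \<in> graded k w"
  by (simp add: graded_def)

lemma graded_ring: "p \<in> coeff_ring \<Longrightarrow> n dvd w \<Longrightarrow> p \<in> graded k w"
  by (rule gradedI[OF b_monomial_1]) auto

lemma graded_dvd: "p \<in> graded k w \<Longrightarrow> n dvd w \<Longrightarrow> p \<in> graded k 0"
  unfolding graded_def by (auto simp: dvd_add_left_iff)

lemma graded_mult:
  assumes "p \<in> graded k w" "q \<in> graded k w'"
  shows "p * q \<in> graded k (w + w')"
proof (cases "p = 0 \<or> q = 0")
  case False
  then obtain \<nu> v \<nu>' v' where p: "b_monomial k \<nu> v" "n dvd v + w" "\<nu> * p \<in> coeff_ring"
    and q: "b_monomial k \<nu>' v'" "n dvd v' + w'" "\<nu>' * q \<in> coeff_ring"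
    using assms by (metis gradedE)
  show ?thesis
  proof (rule gradedI)
    show "b_monomial k (\<nu> * \<nu>') (v + v')" using p(1) q(1) by (rule b_monomial_mult)
    show "n dvd v + v' + (w + w')" using dvd_add[OF p(2) q(2)] by (simp add: ac_simps)
    show "\<nu> * \<nu>' * (p * q) \<in> coeff_ring" using ring_mult[OF p(3) q(3)] by (simp add: ac_simps)
  qed
qed (auto simp: graded_0)

lemma graded_power: "p \<in> graded k w \<Longrightarrow> p ^ r \<in> graded k (r * w)"
  by (induction r) (auto simp: graded_ring ring_1 intro: graded_mult)

text \<open>
  For denominators \<open>\<nu>\<close> of \<open>p\<close> and \<open>\<nu>'\<close> of \<open>q\<close>, both of weight \<open>- w\<close>, the product \<open>\<nu> \<nu>'\<^sup>n\<close> has that weight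
  too. It exceeds them by the factors \<open>\<nu>'\<^sup>n\<close> and \<open>\<nu> \<nu>'\<^bsup>n-1\<^esup>\<close>, which have weight \<open>0\<close>, and so can be moved into
  the coefficient ring by a further monomial.
\<close>

lemma graded_add:
  assumes inv: "invertible_weight_0 k" and "p \<in> graded k w" "q \<in> graded k w"
  shows "p + q \<in> graded k w"
proof (cases "p = 0 \<or> q = 0")
  case False
  then obtain \<nu> v \<nu>' v' where p: "b_monomial k \<nu> v" "n dvd v + w" "\<nu> * p \<in> coeff_ring"
    and q: "b_monomial k \<nu>' v'" "n dvd v' + w" "\<nu>' * q \<in> coeff_ring"
    using assms(2,3) by (metis gradedE)
  let ?x = "\<nu>' ^ n" and ?y = "\<nu> * \<nu>' ^ (n - 1)"
  have n: "Suc (n - 1) = n" using n_pos by simp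
  have x: "b_monomial k ?x (n * v')" by (rule b_monomial_power[OF q(1)])
  have y: "b_monomial k ?y (v + (n - 1) * v')"
    by (intro b_monomial_mult b_monomial_power p q)
  have ydvd: "n dvd v + (n - 1) * v'"
  proof -
    have "n dvd v + w + n * v'" using p(2) by simp
    also have "v + w + n * v' = v + (n - 1) * v' + (v' + w)"
      using n by (metis add.assoc add.commute add.left_commute mult_Suc)
    finally show ?thesis using q(2) by (metis dvd_add_left_iff)
  qed
  from inv x obtain \<rho> r where \<rho>: "b_monomial k \<rho> r" "n dvd r" "\<rho> \<in> coeff_ring" "\<rho> * ?x \<in> coeff_ring"
    unfolding invertible_weight_0_def by (metis dvd_triv_left)
  from inv y ydvd obtain \<sigma> s where \<sigma>: "b_monomial k \<sigma> s" "n dvd s" "\<sigma> \<in> coeff_ring" "\<sigma> * ?y \<in> coeff_ring"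
    unfolding invertible_weight_0_def by metis
  show ?thesis
  proof (rule gradedI)
    show "b_monomial k (\<rho> * \<sigma> * (\<nu> * ?x)) (r + s + (v + n * v'))"
      by (intro b_monomial_mult \<rho> \<sigma> p x)
    show "n dvd r + s + (v + n * v') + w"
    proof -
      have "n dvd (r + s + n * v') + (v + w)"
        by (rule dvd_add[OF _ p(2)]) (use \<rho>(2) \<sigma>(2) in simp)
      then show ?thesis by (simp add: ac_simps)
    qed
    have "?x = \<nu>' * \<nu>' ^ (n - 1)" by (metis n power_Suc)
    then have "\<rho> * \<sigma> * (\<nu> * ?x) * (p + q) =
        \<sigma> * ((\<rho> * ?x) * (\<nu> * p)) + \<rho> * ((\<sigma> * ?y) * (\<nu>' * q))"
      by (simp add: algebra_simps)
    then show "\<rho> * \<sigma> * (\<nu> * ?x) * (p + q) \<in> coeff_ring"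
      using \<rho> \<sigma> p q by (simp add: ring_add ring_mult)
  qed
qed (use assms in auto)

lemma graded_sum:
  "invertible_weight_0 k \<Longrightarrow> (\<And>x. x \<in> S \<Longrightarrow> f x \<in> graded k w) \<Longrightarrow> (\<Sum>x\<in>S. f x) \<in> graded k w"
  by (induction S rule: infinite_finite_induct) (auto simp: graded_0 intro: graded_add)

text \<open>
  The monomial \<open>x\<^sup>n\<close> has weight \<open>0\<close>, so \<open>x\<^bsup>n-1\<^esup>\<close> serves as a denominator of \<open>x\<close>.
\<close>

lemma graded_b_monomial:
  assumes inv: "invertible_weight_0 k" and x: "b_monomial k x w"
  shows "x \<in> graded k w"
proof -
  have n: "Suc (n - 1) = n" using n_pos by simp
  from inv b_monomial_power[OF x, of n] obtain \<nu> v
    where \<nu>: "b_monomial k \<nu> v" "n dvd v" "\<nu> * x ^ n \<in> coeff_ring"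
    unfolding invertible_weight_0_def by (metis dvd_triv_left)
  show ?thesis
  proof (rule gradedI)
    show "b_monomial k (\<nu> * x ^ (n - 1)) (v + (n - 1) * w)"
      by (intro b_monomial_mult b_monomial_power \<nu> x)
    have "v + (n - 1) * w + w = v + n * w" using n by (metis add.assoc add.commute mult_Suc)
    then show "n dvd v + (n - 1) * w + w" using \<nu>(2) by (metis dvd_add dvd_triv_left)
    have "x ^ (n - 1) * x = x ^ n" by (metis n power_Suc2)
    then show "\<nu> * x ^ (n - 1) * x \<in> coeff_ring" using \<nu>(3) by (simp add: mult.assoc)
  qed
qed

lemma graded_cancel:
  assumes "b_monomial k \<mu> u" "\<mu> * p \<in> graded k (u + w)"
  shows "p \<in> graded k w"
proof (cases "p = 0")
  case False
  then have "\<mu> * p \<noteq> 0" using b_monomial_nonzero[OF assms(1)] by simp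
  with assms(2) obtain \<nu> v where \<nu>: "b_monomial k \<nu> v" "n dvd v + (u + w)" "\<nu> * (\<mu> * p) \<in> coeff_ring"
    by (metis gradedE)
  show ?thesis
    by (rule gradedI[OF b_monomial_mult[OF \<nu>(1) assms(1)]]) (use \<nu> in \<open>simp_all add: ac_simps\<close>)
qed (simp add: graded_0)

lemma graded_Suc: "p \<in> graded k w \<Longrightarrow> p \<in> graded (Suc k) w"
  unfolding graded_def by (blast intro: b_monomial_Suc)

text \<open>
  A denominator of an element of weight \<open>0\<close> has weight \<open>0\<close> itself, so it can be enlarged to one that
  belongs to the coefficient ring.
\<close>

lemma graded_weight_0:
  assumes inv: "invertible_weight_0 k" and p: "p \<in> graded k w" "n dvd w"
  obtains \<nu> v where "b_monomial k \<nu> v" "n dvd v" "\<nu> \<in> coeff_ring" "\<nu> * p \<in> coeff_ring"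
proof (cases "p = 0")
  case True
  then show ?thesis using that[OF b_monomial_1] by (simp add: ring_0 ring_1)
next
  case False
  with p obtain \<nu> v where \<nu>: "b_monomial k \<nu> v" "n dvd v" "\<nu> * p \<in> coeff_ring"
    by (metis gradedE dvd_add_left_iff)
  with inv obtain \<rho> r where \<rho>: "b_monomial k \<rho> r" "n dvd r" "\<rho> \<in> coeff_ring" "\<rho> * \<nu> \<in> coeff_ring"
    unfolding invertible_weight_0_def by metis
  show ?thesis
  proof (rule that)
    show "b_monomial k (\<rho> * \<nu>) (r + v)" by (rule b_monomial_mult) fact+
    show "\<rho> * \<nu> * p \<in> coeff_ring" using ring_mult[OF \<rho>(3) \<nu>(3)] by (simp add: mult.assoc)
  qed (use \<nu> \<rho> in auto)
qed

section \<open>Leading coefficients along truncations of the series\<close>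

definition graded_series :: "nat \<Rightarrow> nat cpoly fps \<Rightarrow> bool" where
  "graded_series k g \<longleftrightarrow> (\<forall>l. fps_nth g l \<in> graded k l)"

lemma graded_series_add:
  "invertible_weight_0 k \<Longrightarrow> graded_series k g \<Longrightarrow> graded_series k h \<Longrightarrow> graded_series k (g + h)"
  by (auto simp: graded_series_def intro: graded_add)

lemma graded_series_mult:
  assumes inv: "invertible_weight_0 k" and g: "graded_series k g" and h: "graded_series k h"
  shows "graded_series k (g * h)"
  unfolding graded_series_def fps_mult_nth
proof (intro allI graded_sum[OF inv])
  fix l j :: nat
  assume "j \<in> {0..l}"
  moreover have "fps_nth g j * fps_nth h (l - j) \<in> graded k (j + (l - j))"
    using g h by (intro graded_mult) (auto simp: graded_series_def)
  ultimately show "fps_nth g j * fps_nth h (l - j) \<in> graded k l" by simp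
qed

lemma graded_series_0: "graded_series k 0"
  by (simp add: graded_series_def graded_0)

lemma graded_series_pcompose:
  assumes inv: "invertible_weight_0 k" and \<beta>: "graded_series k \<beta>"
    and "\<And>j. graded_series k (poly.coeff f j)"
  shows "graded_series k (poly.coeff (pcompose f [:\<beta>, 1:]) s)"
  using assms(3)
proof (induction f arbitrary: s)
  case (pCons a f)
  have a: "graded_series k a" using pCons.prems[of 0] by simp
  have f: "graded_series k (poly.coeff (pcompose f [:\<beta>, 1:]) r)" for r
    using pCons.prems[of "Suc _"] by (intro pCons.IH) simp
  have 1: "graded_series k (poly.coeff [:a:] s)"
    using a by (cases s) (simp_all add: graded_series_0)
  have 2: "graded_series k (case s of 0 \<Rightarrow> 0 | Suc l \<Rightarrow> 1 * poly.coeff (pcompose f [:\<beta>, 1:]) l)"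
    using f by (cases s) (simp_all add: graded_series_0)
  show ?case
    unfolding pcompose_pCons coeff_add coeff_linear_factor_mult
    by (intro graded_series_add graded_series_mult inv \<beta> f 1 2)
qed (simp add: graded_series_0)

lemma graded_series_weierstrass: "graded_series k (poly.coeff (weierstrass_product n I) j)"
  unfolding graded_series_def weierstrass_product_nth[OF n_pos]
  by (auto intro: graded_ring ring_F graded_0)

definition truncation :: "nat \<Rightarrow> nat cpoly fps" where
  "truncation i = Abs_fps (\<lambda>l. if l \<in> I \<and> l < i then Var l else 0)"

lemma truncation_diff_nth:
  "fps_nth (truncation i - generic_series I \<epsilon>) j =
    (if j \<in> I then (if j < i then Const (1 - \<epsilon> ^ j) else - Const (\<epsilon> ^ j)) * Var j else 0)"
  by (simp add: truncation_def generic_series_def Const_diff Const_1 algebra_simps)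

text \<open>
  The index \<open>b\<^sub>l\<close> is the order of contact of \<open>\<alpha>(T)\<close> with \<open>\<alpha>(\<epsilon>T)\<close>: for the least \<open>l\<close> such that \<open>\<epsilon>\<close> is not
  an \<open>e\<^sub>l\<close>-th root of unity, all earlier indices are divisible by \<open>e\<^bsub>l-1\<^esub>\<close>, whereas
  \<open>\<epsilon>\<^bsup>b\<^sub>l\<^esup> = 1\<close> would make the order of \<open>\<epsilon>\<close> divide \<open>gcd e\<^bsub>l-1\<^esub> b\<^sub>l = e\<^sub>l\<close>.
\<close>

lemma conjugate_separates:
  assumes "\<epsilon> \<in> unity_roots n" "\<epsilon> \<notin> unity_roots (e k)" "k \<le> m"
  obtains l where "l \<in> {1..k}" "\<epsilon> ^ b l \<noteq> 1" "\<And>j. j \<in> I \<Longrightarrow> j < b l \<Longrightarrow> \<epsilon> ^ j = 1"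
proof -
  define l where "l = (LEAST l. \<epsilon> \<notin> unity_roots (e l))"
  have out: "\<epsilon> \<notin> unity_roots (e l)" unfolding l_def by (rule LeastI[of _ k]) fact
  have lk: "l \<le> k" unfolding l_def by (rule Least_le) fact
  have "l \<noteq> 0" using out assms(1) by (metis gcd_0)
  then obtain t where t: "l = Suc t" by (cases l) auto
  have inn: "\<epsilon> \<in> unity_roots (e t)"
    using not_less_Least[of t "\<lambda>l. \<epsilon> \<notin> unity_roots (e l)"] t unfolding l_def by auto
  show ?thesis
  proof
    show "l \<in> {1..k}" using t lk by auto
    show "\<epsilon> ^ b l \<noteq> 1"
      using out inn unfolding t gcd_Suc unity_roots_gcd[OF gcd_pos] by auto
    fix j
    assume "j \<in> I" "j < b l"
    then have "e t dvd j" using t lk assms(3) by (intro gcd_dvd_index) auto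
    then show "\<epsilon> ^ j = 1"
      using inn by (auto simp: unity_roots_def power_mult elim!: dvdE)
  qed
qed

text \<open>
  To extract the terms of lowest order, substitute \<open>T\<^sup>i Z\<close> for \<open>Z\<close>. Each factor
  \<open>T\<^sup>i Z + \<beta>(T) - \<alpha>(\<epsilon>T)\<close> is then divisible by \<open>T\<close> to the order of \<open>\<beta>(T) - \<alpha>(\<epsilon>T)\<close>, which is at most \<open>i\<close>. At
  \<open>T = 0\<close> the quotient is \<open>Z - \<epsilon>\<^sup>i A\<^sub>i\<close> if this order is \<open>i\<close>, and otherwise the constant
  \<open>(1 - \<epsilon>\<^bsup>b\<^sub>l\<^esup>) A\<^bsub>b\<^sub>l\<^esub>\<close>. The coefficient of \<open>Z\<close> to the power \<open>e\<^sub>k - d\<close> is taken because it carries the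
  lowest positive power of \<open>A\<^sub>i\<close>.
\<close>

lemma leading_coefficient:
  assumes km: "k \<le> m" and i: "i \<in> I" "1 \<le> k \<Longrightarrow> b k < i" "k < m \<Longrightarrow> i \<le> b (Suc k)"
  defines "d \<equiv> e k div gcd (e k) i"
  obtains c \<mu> u where "c \<noteq> 0" "b_monomial k \<mu> u"
    "fps_nth (poly.coeff (pcompose (weierstrass_product n I) [:truncation i, 1:]) (e k - d)) (u + i * d)
      = Const c * (\<mu> * Var i ^ d)"
proof -
  let ?U = "unity_roots n" and ?E = "unity_roots (e k)" and ?s = "e k - d"
  let ?f = "weierstrass_product n I"
  let ?\<Delta> = "\<lambda>\<epsilon>. truncation i - generic_series I \<epsilon>"
  have d_le: "d \<le> e k" unfolding d_def by simp
  have EU: "?E \<subseteq> ?U"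
    using gcd_dvd_b[of 0 k] by (auto simp: unity_roots_def power_mult elim!: dvdE)
  have finU: "finite ?U" using n_pos by (intro finite_unity_roots) simp
  have "\<exists>l. l \<in> {1..k} \<and> \<epsilon> ^ b l \<noteq> 1 \<and> (\<forall>j\<in>I. j < b l \<longrightarrow> \<epsilon> ^ j = 1)" if "\<epsilon> \<in> ?U - ?E" for \<epsilon>
  proof -
    from that have "\<epsilon> \<in> ?U" "\<epsilon> \<notin> ?E" by auto
    then show ?thesis by (rule conjugate_separates[OF _ _ km]) blast
  qed
  then obtain l where l: "\<And>\<epsilon>. \<epsilon> \<in> ?U - ?E \<Longrightarrow>
      l \<epsilon> \<in> {1..k} \<and> \<epsilon> ^ b (l \<epsilon>) \<noteq> 1 \<and> (\<forall>j\<in>I. j < b (l \<epsilon>) \<longrightarrow> \<epsilon> ^ j = 1)"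
    by metis
  define ord where "ord \<epsilon> = (if \<epsilon> \<in> ?E then i else b (l \<epsilon>))" for \<epsilon>
  define lead where "lead \<epsilon> =
    (if \<epsilon> \<in> ?E then - (Const (\<epsilon> ^ i) * Var i) else Const (1 - \<epsilon> ^ b (l \<epsilon>)) * Var (b (l \<epsilon>)))" for \<epsilon>
  define h where "h \<epsilon> = fps_shift (ord \<epsilon>) (?\<Delta> \<epsilon>)" for \<epsilon>
  have bl_less: "b (l \<epsilon>) < i" if "\<epsilon> \<in> ?U - ?E" for \<epsilon>
    using l[OF that] b_le[of "l \<epsilon>" k] km i(2) by fastforce
  have ord_le: "ord \<epsilon> \<le> i" if "\<epsilon> \<in> ?U" for \<epsilon>
    using bl_less[of \<epsilon>] that by (auto simp: ord_def)
  have low: "fps_nth (?\<Delta> \<epsilon>) j = 0" if "\<epsilon> \<in> ?U" "j < ord \<epsilon>" for \<epsilon> j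
  proof -
    have "j < i" using ord_le[OF that(1)] that(2) by simp
    moreover have "\<epsilon> ^ j = 1" if "j \<in> I"
    proof (cases "\<epsilon> \<in> ?E")
      case True
      have "e k dvd j"
        using \<open>j \<in> I\<close> \<open>j < i\<close> i(3) km by (intro gcd_dvd_index) auto
      with True show ?thesis by (auto simp: unity_roots_def power_mult elim!: dvdE)
    next
      case False
      then show ?thesis
        using l[of \<epsilon>] \<open>\<epsilon> \<in> ?U\<close> \<open>j < ord \<epsilon>\<close> \<open>j \<in> I\<close> by (auto simp: ord_def)
    qed
    ultimately show ?thesis by (simp add: truncation_diff_nth Const_0 del: fps_sub_nth)
  qed
  have \<Delta>: "?\<Delta> \<epsilon> = fps_X ^ ord \<epsilon> * h \<epsilon>" if "\<epsilon> \<in> ?U" for \<epsilon>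
    by (rule fps_ext) (use low[OF that] in \<open>simp add: h_def fps_X_power_mult_nth\<close>)
  have h0: "fps_nth (h \<epsilon>) 0 = lead \<epsilon>" if "\<epsilon> \<in> ?U" for \<epsilon>
  proof (cases "\<epsilon> \<in> ?E")
    case True
    with i(1) show ?thesis by (simp add: h_def ord_def lead_def truncation_diff_nth del: fps_sub_nth)
  next
    case False
    with that have "\<epsilon> \<in> ?U - ?E" by simp
    with l[OF this] bl_less[OF this] km False show ?thesis
      by (auto simp: h_def ord_def lead_def truncation_diff_nth b_in_index simp del: fps_sub_nth)
  qed

  \<comment> \<open>Extract \<open>T\<close> to the order of each factor, then set \<open>T = 0\<close> in the remaining product.\<close>
  have "pcompose ?f [:truncation i, fps_X ^ i:] = (\<Prod>\<epsilon>\<in>?U. [:?\<Delta> \<epsilon>, fps_X ^ i:])"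
    unfolding weierstrass_product_def pcompose_prod by (simp add: pcompose_pCons)
  also have "\<dots> = (\<Prod>\<epsilon>\<in>?U. smult (fps_X ^ ord \<epsilon>) [:h \<epsilon>, fps_X ^ (i - ord \<epsilon>):])"
    using \<Delta> ord_le by (intro prod.cong) (simp_all flip: power_add)
  also have "\<dots> = smult (fps_X ^ (\<Sum>\<epsilon>\<in>?U. ord \<epsilon>)) (\<Prod>\<epsilon>\<in>?U. [:h \<epsilon>, fps_X ^ (i - ord \<epsilon>):])"
    unfolding prod_smult power_sum ..
  finally have "fps_nth (poly.coeff (pcompose ?f [:truncation i, fps_X ^ i:]) ?s) (\<Sum>\<epsilon>\<in>?U. ord \<epsilon>) =
      poly.coeff (\<Prod>\<epsilon>\<in>?U. [:fps_nth (h \<epsilon>) 0, fps_nth (fps_X ^ (i - ord \<epsilon>)) 0:]) ?s"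
    by (simp add: fps_X_power_mult_nth nth_coeff_prod_linear)
  also have "(\<Prod>\<epsilon>\<in>?U. [:fps_nth (h \<epsilon>) 0, fps_nth (fps_X ^ (i - ord \<epsilon>)) 0:]) =
      (\<Prod>\<epsilon>\<in>?U. [:lead \<epsilon>, if \<epsilon> \<in> ?E then 1 else 0:])"
  proof (intro prod.cong refl)
    fix \<epsilon>
    assume "\<epsilon> \<in> ?U"
    moreover have "0 < i - ord \<epsilon>" if "\<epsilon> \<notin> ?E"
      using bl_less[of \<epsilon>] \<open>\<epsilon> \<in> ?U\<close> that by (simp add: ord_def)
    ultimately show "[:fps_nth (h \<epsilon>) 0, fps_nth (fps_X ^ (i - ord \<epsilon>)) 0:] =
        [:lead \<epsilon>, if \<epsilon> \<in> ?E then 1 else 0:]"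
      using h0 by (cases "\<epsilon> \<in> ?E") (simp_all add: ord_def)
  qed
  also have "\<dots> = (\<Prod>\<epsilon>\<in>?U - ?E. [:lead \<epsilon>:]) * (\<Prod>\<epsilon>\<in>?E. [:- (Const (\<epsilon> ^ i) * Var i), 1:])"
    unfolding prod.subset_diff[OF EU finU]
    by (intro arg_cong2[where f = "(*)"] prod.cong) (auto simp: lead_def)
  also have "(\<Prod>\<epsilon>\<in>S. [:lead \<epsilon>:]) = [:\<Prod>\<epsilon>\<in>S. lead \<epsilon>:]" for S
    by (induction S rule: infinite_finite_induct) (simp_all add: one_pCons)
  finally have lhs: "fps_nth (poly.coeff (pcompose ?f [:truncation i, fps_X ^ i:]) ?s) (\<Sum>\<epsilon>\<in>?U. ord \<epsilon>) =
      (\<Prod>\<epsilon>\<in>?U - ?E. lead \<epsilon>) * poly.coeff (\<Prod>\<epsilon>\<in>?E. [:- (Const (\<epsilon> ^ i) * Var i), 1:]) ?s"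
    by simp

  let ?\<mu> = "\<Prod>\<epsilon>\<in>?U - ?E. Var (b (l \<epsilon>)) :: nat cpoly" and ?u = "\<Sum>\<epsilon>\<in>?U - ?E. b (l \<epsilon>)"
  let ?c = "\<Prod>\<epsilon>\<in>?U - ?E. 1 - \<epsilon> ^ b (l \<epsilon>)"
  have \<mu>: "b_monomial k ?\<mu> ?u"
    by (intro b_monomial_prod b_monomial_Var) (use l in auto)
  have c0: "?c \<noteq> 0" using l finU by auto
  have "(\<Prod>\<epsilon>\<in>?U - ?E. lead \<epsilon>) = (\<Prod>\<epsilon>\<in>?U - ?E. Const (1 - \<epsilon> ^ b (l \<epsilon>)) * Var (b (l \<epsilon>)))"
    by (rule prod.cong) (auto simp: lead_def)
  then have lead: "(\<Prod>\<epsilon>\<in>?U - ?E. lead \<epsilon>) = Const ?c * ?\<mu>"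
    by (simp add: prod.distrib Const_prod)

  have "poly.coeff (\<Prod>\<epsilon>\<in>?E. [:- (Const (\<epsilon> ^ i) * Var i), 1:]) ?s * Var i ^ ?s =
      Const (- of_nat (gcd (e k) i)) * Var i ^ e k"
    unfolding coeff_prod_homogeneous card_unity_roots[OF gcd_pos]
    by (simp add: d_def coeff_prod_unity_root_powers[OF gcd_pos])
  also have "\<dots> = (Const (- of_nat (gcd (e k) i)) * Var i ^ d) * Var i ^ ?s"
    using d_le by (simp add: mult.assoc flip: power_add)
  finally have E: "poly.coeff (\<Prod>\<epsilon>\<in>?E. [:- (Const (\<epsilon> ^ i) * Var i), 1:]) ?s =
      Const (- of_nat (gcd (e k) i)) * Var i ^ d"
    using Var_nonzero[of i] by simp

  \<comment> \<open>Undoing the substitution shifts the coefficient of \<open>Z\<^sup>s\<close> by \<open>T\<^sup>i\<^sup>s\<close>.\<close>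
  have "pcompose ?f [:truncation i, fps_X ^ i:] =
      pcompose (pcompose ?f [:truncation i, 1:]) [:0, fps_X ^ i:]"
    by (simp add: pcompose_pCons flip: pcompose_assoc)
  then have "poly.coeff (pcompose ?f [:truncation i, fps_X ^ i:]) ?s =
      fps_X ^ (i * ?s) * poly.coeff (pcompose ?f [:truncation i, 1:]) ?s"
    by (simp add: coeff_pcompose_linear flip: power_mult)
  moreover have "(\<Sum>\<epsilon>\<in>?U. ord \<epsilon>) = i * ?s + (?u + i * d)"
  proof -
    have "(\<Sum>\<epsilon>\<in>?U. ord \<epsilon>) = (\<Sum>\<epsilon>\<in>?U - ?E. b (l \<epsilon>)) + (\<Sum>\<epsilon>\<in>?E. i)"
      unfolding sum.subset_diff[OF EU finU]
      by (intro arg_cong2[where f = "(+)"] sum.cong) (auto simp: ord_def)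
    also have "(\<Sum>\<epsilon>\<in>?E. i) = i * ?s + i * d"
      using d_le by (simp add: card_unity_roots[OF gcd_pos] flip: distrib_left)
    finally show ?thesis by simp
  qed
  ultimately have "fps_nth (poly.coeff (pcompose ?f [:truncation i, 1:]) ?s) (?u + i * d) =
      fps_nth (poly.coeff (pcompose ?f [:truncation i, fps_X ^ i:]) ?s) (\<Sum>\<epsilon>\<in>?U. ord \<epsilon>)"
    by (simp add: fps_X_power_mult_nth)
  also have "\<dots> = Const (?c * - of_nat (gcd (e k) i)) * (?\<mu> * Var i ^ d)"
    unfolding lhs lead E Const_mult by (simp add: mult_ac)
  finally show ?thesis
    by (rule that[rotated 2]) (use \<mu> c0 gcd_pos[of k] in simp_all)
qed

section \<open>All variables are graded\<close>

text \<open>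
  The coefficient in \<open>leading_coefficient\<close> is built from the \<open>F\<^sub>i\<^sub>j\<close> and the variables before \<open>A\<^sub>i\<close>, all
  graded, and the coefficient of \<open>T\<^sup>l\<close> always has weight \<open>l\<close>. The constant \<open>c\<close> and the monomial \<open>\<mu>\<close> cancel.
\<close>

lemma graded_Var_power:
  assumes inv: "invertible_weight_0 k" and k: "k \<le> m"
    and i: "i \<in> I" "1 \<le> k \<Longrightarrow> b k < i" "k < m \<Longrightarrow> i \<le> b (Suc k)"
    and below: "\<And>l. l \<in> I \<Longrightarrow> l < i \<Longrightarrow> Var l \<in> graded k l"
  defines "d \<equiv> e k div gcd (e k) i"
  shows "Var i ^ d \<in> graded k (i * d)"
proof -
  obtain c \<mu> u where c: "c \<noteq> 0" and \<mu>: "b_monomial k \<mu> u" and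
    eq: "fps_nth (poly.coeff (pcompose (weierstrass_product n I) [:truncation i, 1:]) (e k - d)) (u + i * d)
      = Const c * (\<mu> * Var i ^ d)"
    unfolding d_def by (rule leading_coefficient[OF k i])
  have "graded_series k (truncation i)"
    using below by (auto simp: graded_series_def truncation_def graded_0)
  then have "graded_series k (poly.coeff (pcompose (weierstrass_product n I) [:truncation i, 1:]) (e k - d))"
    by (intro graded_series_pcompose inv graded_series_weierstrass)
  then have "Const c * (\<mu> * Var i ^ d) \<in> graded k (u + i * d)"
    unfolding graded_series_def eq[symmetric] by blast
  moreover have "Const (1 / c) \<in> graded k 0"
    by (rule graded_ring[OF ring_Const]) simp
  ultimately have "Const (1 / c) * (Const c * (\<mu> * Var i ^ d)) \<in> graded k (0 + (u + i * d))"
    using graded_mult by blast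
  also have "Const (1 / c) * (Const c * (\<mu> * Var i ^ d)) = Const (1 / c * c) * (\<mu> * Var i ^ d)"
    unfolding Const_mult by (simp add: mult_ac)
  also have "\<dots> = \<mu> * Var i ^ d"
    using c by (simp add: Const_1)
  finally have "\<mu> * Var i ^ d \<in> graded k (u + i * d)" by simp
  then show ?thesis by (rule graded_cancel[OF \<mu>])
qed

text \<open>
  Below \<open>b\<^bsub>k+1\<^esub>\<close> all indices are divisible by \<open>e\<^sub>k\<close>, so beyond \<open>b\<^sub>k\<close> the power in
  \<open>graded_Var_power\<close> is the variable itself. At \<open>k = m\<close> this covers the whole tail of the index set.
\<close>

lemma graded_Var_up_to_next:
  assumes inv: "invertible_weight_0 k" and k: "k \<le> m"
    and below: "\<And>i. i \<in> I \<Longrightarrow> 1 \<le> k \<Longrightarrow> i \<le> b k \<Longrightarrow> Var i \<in> graded k i"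
    and "i \<in> I" "k < m \<Longrightarrow> i < b (Suc k)"
  shows "Var i \<in> graded k i"
  using assms(4,5)
proof (induction i rule: less_induct)
  case (less i)
  show ?case
  proof (cases "1 \<le> k \<and> i \<le> b k")
    case True
    with below less.prems show ?thesis by blast
  next
    case False
    have "e k dvd i" using less.prems k by (intro gcd_dvd_index) auto
    then have "e k div gcd (e k) i = 1" using gcd_pos[of k] by (simp add: gcd_nat.absorb1)
    moreover have "Var l \<in> graded k l" if "l \<in> I" "l < i" for l
      using less.IH[OF that(2,1)] less.prems(2) that(2) by force
    then have "Var i ^ (e k div gcd (e k) i) \<in> graded k (i * (e k div gcd (e k) i))"
      using False less.prems by (intro graded_Var_power inv k) auto
    ultimately show ?thesis by simp
  qed
qed

text \<open>
  If \<open>y A\<^sub>c\<^sup>r\<close>, with \<open>c = b\<^bsub>k+1\<^esub>\<close> and \<open>y\<close> a monomial of level \<open>k\<close>, has weight \<open>0\<close> modulo \<open>n\<close>, then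
  \<open>e\<^sub>k\<close> divides \<open>r c\<close>, because it divides \<open>n\<close> and the weight of \<open>y\<close>. So \<open>r\<close> is a multiple of
  \<open>d = e\<^sub>k / gcd e\<^sub>k c\<close>, and the monomial is a product of graded elements already at level \<open>k\<close>.
\<close>

lemma invertible_weight_0_Suc:
  assumes inv: "invertible_weight_0 k" and k: "Suc k \<le> m"
    and below: "\<And>i. i \<in> I \<Longrightarrow> i < b (Suc k) \<Longrightarrow> Var i \<in> graded k i"
  shows "invertible_weight_0 (Suc k)"
  unfolding invertible_weight_0_def
proof (intro allI impI, elim conjE)
  fix x w
  assume x: "b_monomial (Suc k) x w" and w: "n dvd w"
  let ?b = "b (Suc k)"
  let ?g = "gcd (e k) ?b"
  define d where "d = e k div ?g"
  have power: "Var ?b ^ d \<in> graded k (?b * d)"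
    unfolding d_def
  proof (rule graded_Var_power[OF inv])
    show "?b \<in> I" using k by (intro b_in_index) simp
    show "b k < ?b" if "1 \<le> k" using that k by (intro b_less) auto
  qed (use k below in auto)
  obtain r y v where x_eq: "x = y * Var ?b ^ r" "w = v + r * ?b" and y: "b_monomial k y v"
    using x unfolding b_monomial_Suc_iff by blast
  have "d dvd r"
  proof -
    have "e k dvd v + r * ?b" using w gcd_dvd_b[of 0 k] x_eq by (metis dvd_trans le0)
    then have "e k dvd r * ?b" using gcd_dvd_weight[OF y] by (metis dvd_add_right_iff)
    then have "d * ?g dvd r * (?b div ?g) * ?g" by (simp add: d_def mult.assoc)
    moreover have "?g \<noteq> 0" using gcd_pos[of k] by simp
    ultimately have "d dvd r * (?b div ?g)" using gcd_pos[of k] by simp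
    moreover have "coprime d (?b div ?g)"
      unfolding d_def using gcd_pos[of k] by (intro div_gcd_coprime) auto
    ultimately show ?thesis by (simp add: coprime_dvd_mult_left_iff)
  qed
  then obtain q where q: "r = d * q" by (auto elim: dvdE)
  have "y * (Var ?b ^ d) ^ q \<in> graded k (v + q * (?b * d))"
    by (intro graded_mult graded_power power graded_b_monomial inv y)
  then have "x \<in> graded k w"
    using x_eq q by (simp add: power_mult mult_ac)
  then obtain \<nu> u where "b_monomial k \<nu> u" "n dvd u" "\<nu> \<in> coeff_ring" "\<nu> * x \<in> coeff_ring"
    by (rule graded_weight_0[OF inv _ w])
  then show "\<exists>\<nu> v. b_monomial (Suc k) \<nu> v \<and> n dvd v \<and> \<nu> \<in> coeff_ring \<and> \<nu> * x \<in> coeff_ring"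
    by (blast intro: b_monomial_Suc)
qed

lemma graded_Var_up_to_b:
  assumes "k \<le> m"
  shows "invertible_weight_0 k \<and> (\<forall>i\<in>I. 1 \<le> k \<longrightarrow> i \<le> b k \<longrightarrow> Var i \<in> graded k i)"
  using assms
proof (induction k)
  case 0
  have "b_monomial 0 x w \<longleftrightarrow> x = 1 \<and> w = 0" for x w
    by (auto simp: b_monomial_def)
  then show ?case by (auto simp: invertible_weight_0_def ring_1)
next
  case (Suc k)
  then have inv: "invertible_weight_0 k"
    and up_to_b: "\<And>i. i \<in> I \<Longrightarrow> 1 \<le> k \<Longrightarrow> i \<le> b k \<Longrightarrow> Var i \<in> graded k i"
    by simp_all
  have below: "Var i \<in> graded k i" if "i \<in> I" "i < b (Suc k)" for i
    using Suc.prems by (intro graded_Var_up_to_next[OF inv _ up_to_b] that) auto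
  have inv': "invertible_weight_0 (Suc k)"
    by (rule invertible_weight_0_Suc[OF inv Suc.prems below])
  have "Var i \<in> graded (Suc k) i" if "i \<in> I" "i \<le> b (Suc k)" for i
  proof (cases "i = b (Suc k)")
    case True
    then show ?thesis
      using graded_b_monomial[OF inv' b_monomial_Var[of "Suc k" "Suc k"]] by simp
  next
    case False
    with that below show ?thesis by (intro graded_Suc) simp
  qed
  with inv' show ?case by blast
qed

lemma invertible_weight_0_last: "invertible_weight_0 m"
  using graded_Var_up_to_b[of m] by simp

lemma graded_Var: "i \<in> I \<Longrightarrow> Var i \<in> graded m i"
  by (rule graded_Var_up_to_next[OF invertible_weight_0_last order_refl])
    (use graded_Var_up_to_b[of m] in simp_all)

lemma graded_monomial_value:
  assumes "Poly_Mapping.keys u \<subseteq> I"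
  shows "monomial_value Var u \<in> graded m (weight u)"
proof -
  have "(\<Prod>v\<in>S. Var v ^ a v) \<in> graded m (\<Sum>v\<in>S. v * a v)" if "S \<subseteq> I" for S and a :: "nat \<Rightarrow> nat"
    using that
  proof (induction S rule: infinite_finite_induct)
    case (insert v S)
    have "Var v ^ a v \<in> graded m (a v * v)" using insert.prems by (intro graded_power graded_Var) auto
    from graded_mult[OF this insert.IH] insert show ?case by (simp add: mult.commute)
  qed (simp_all add: graded_ring ring_1)
  with assms show ?thesis by (simp add: monomial_value_def weight_def)
qed

lemma invariant_graded:
  assumes "vars Q \<subseteq> I" "unity_invariant n Q"
  shows "Q \<in> graded m 0"
proof -
  have "(\<Sum>u\<in>Poly_Mapping.keys Q. Const (Poly_Mapping.lookup Q u) * monomial_value Var u) \<in> graded m 0"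
  proof (rule graded_sum[OF invertible_weight_0_last])
    fix u
    assume u: "u \<in> Poly_Mapping.keys Q"
    then have "Poly_Mapping.keys u \<subseteq> I" using assms(1) by (auto simp: vars_def)
    then have "Const (Poly_Mapping.lookup Q u) * monomial_value Var u \<in> graded m (0 + weight u)"
      by (intro graded_mult graded_monomial_value graded_ring ring_Const) auto
    moreover have "n dvd weight u"
      using unity_invariant_imp_weight[OF assms(2) _ u] n_pos by simp
    ultimately show "Const (Poly_Mapping.lookup Q u) * monomial_value Var u \<in> graded m 0"
      by (simp add: graded_dvd)
  qed
  also have "(\<Sum>u\<in>Poly_Mapping.keys Q. Const (Poly_Mapping.lookup Q u) * monomial_value Var u) = Q"
    by (simp add: monomial_value_Var Const_def mult_single flip: sum_singles)
  finally show ?thesis .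
qed

end

theorem theorem1:
  fixes b :: "nat \<Rightarrow> nat" and m n :: nat and I :: "nat set"
    and F :: "nat \<times> nat \<Rightarrow> nat cpoly" and Q :: "nat cpoly"
  assumes "characteristic_sequence b m"
    and "n = b 0"
    and "I = index_set b m"
    and "F = weierstrass_coeff n I"
    and "vars Q \<subseteq> I"
    and "unity_invariant n Q"
  shows "\<exists>V W :: (nat \<times> nat) cpoly.
    (\<exists>d :: nat \<Rightarrow> nat. subst F V = (\<Prod>k\<in>{1..m}. Var (b k) ^ d k)) \<and>
    Fraction_Field.Fract Q 1 =
      Fraction_Field.Fract (subst F W) 1 / Fraction_Field.Fract (subst F V) 1"
proof -
  interpret char_seq b m using assms(1) by unfold_locales
  have "Q \<in> graded m 0" using assms invariant_graded by simp
  then obtain \<nu> v where \<nu>: "b_monomial m \<nu> v" "\<nu> \<in> coeff_ring" "\<nu> * Q \<in> coeff_ring"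
    by (rule graded_weight_0[OF invertible_weight_0_last _ dvd_0_right])
  then have "\<nu> \<in> range (subst F)" "\<nu> * Q \<in> range (subst F)"
    using assms(2-4) by (simp_all add: coeff_ring_def)
  then obtain V W where V: "subst F V = \<nu>" and W: "subst F W = \<nu> * Q"
    by (elim rangeE) auto
  obtain d where "\<nu> = (\<Prod>k\<in>{1..m}. Var (b k) ^ d k)"
    using \<nu>(1) unfolding b_monomial_def by blast
  moreover have "Fraction_Field.Fract Q 1 = Fraction_Field.Fract (\<nu> * Q) 1 / Fraction_Field.Fract \<nu> 1"
    using b_monomial_nonzero[OF \<nu>(1)] by (simp add: eq_fract mult.commute)
  ultimately show ?thesis
    using V W by (intro exI[of _ V] exI[of _ W]) auto
qed

end
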